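(* Let $H$ be a real Hilbert space, $m\ge 2$ an integer, and for $j=1,\dots,m$ let $C_j$ be a nonempty closed convex subset of $H$. Let $X:=H^m$, $C:=C_1\times\cdots\times C_m$, and let $R,S,Y,\sigma_C,D$ be as defined in the context. Then there exist $d,e\in Y$ such that $$\sigma_C(Se)+\langle Sx-Se,e\rangle-\sigma_C(Sx)\le 0\quad\text{for all }x\in X,\qquad\text{and}\qquad d=Se\in D;$$ and for any such $d,e$, the vector $v=(v_1,\dots,v_m):=-R^{m-1}d\in H^m$ satisfies $v_1+\cdots+v_m=0$ and $$\{z_m:\ (z_1,\dots,z_m)\text{ is a cycle}\}=C_m\cap(C_{m-1}+v_{m-1})\cap(C_{m-2}+v_{m-2}+v_{m-1})\cap\cdots\cap\Big(C_1+\sum_{i=1}^{m-1}v_i\Big),$$ that is, the set on the left equals $\bigcap_{k=1}^{m}\big(C_k+\sum_{i=k}^{m-1}v_i\big)$ (where the empty sum for $k=m$ is $0$).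
   Context: All spaces are real. For $j=1,\dots,m$, $P_j$ denotes the projection (nearest-point map) of $H$ onto $C_j$. An element $z=(z_1,\dots,z_m)\in H^m$ is called a cycle if $z_1=P_1z_m,\ z_2=P_2z_1,\ \dots,\ z_m=P_mz_{m-1}$. $X=H^m$ carries the Hilbert space structure $\langle x,y\rangle=\sum_{i=1}^m\langle x_i,y_i\rangle$. $R\colon X\to X$ is the cyclic shift $R(x_1,x_2,\dots,x_m):=(x_m,x_1,\dots,x_{m-1})$, and $S:=R-I_X$, so $S(x_1,\dots,x_m)=(x_m-x_1,x_1-x_2,\dots,x_{m-1}-x_m)$. $Y:=\{y\in X:\ \frac1m\sum_{i=1}^mR^iy=0\}=\{y\in X:\ \sum_{i=1}^m y_i=0\}$. The support function of $C$ is $\sigma_C(t):=\sup_{c\in C}\langle c,t\rangle\in(-\infty,+\infty]$ (an inequality $a-\sigma_C(Sx)\le0$ with $a$ real is regarded as true when $\sigma_C(Sx)=+\infty$). $D:=\{y\in Y:\ \sigma_C(y)+\frac12\|y\|^2\le0\}$. For a set $E\subset H$ and $w\in H$, $E+w:=\{u+w:u\in E\}$. *)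

theory Defs
  imports "HOL-Analysis.Analysis"
begin

text \<open>
  The space \<open>H\<^sup>m\<close> is rendered as \<open>'h ^ 'n\<close>, where the finite linearly ordered type \<open>'n\<close> plays the
  role of the index set \<open>1 < 2 < \<dots> < m\<close>: thus \<open>m\<close> is \<open>CARD('n)\<close>, the index \<open>1\<close> is \<open>Min UNIV\<close> and
  the index \<open>m\<close> is \<open>Max UNIV\<close>.  The inner product of the library on \<open>'h ^ 'n\<close> is the sum of the
  componentwise inner products.
\<close>

definition cyc_pred :: "'n::{finite,linorder} \<Rightarrow> 'n" where
  "cyc_pred i = (if i = Min UNIV then Max UNIV else Max {j. j < i})"

text \<open>Along the increasing enumeration of the index type, \<open>cyc_pred\<close> maps
  \<open>1\<close> to \<open>m\<close> and \<open>k + 1\<close> to \<open>k\<close>.\<close>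

lemma cyc_pred_enum:
  fixes f :: "nat \<Rightarrow> 'n::{finite,linorder}"
  assumes bij: "bij_betw f {1..CARD('n)} UNIV"
    and mono: "strict_mono_on {1..CARD('n)} f"
  shows "cyc_pred (f 1) = f CARD('n)"
    and "\<And>k. 1 \<le> k \<Longrightarrow> k < CARD('n) \<Longrightarrow> cyc_pred (f (Suc k)) = f k"
proof -
  have surj: "\<exists>k\<in>{1..CARD('n)}. i = f k" for i
    using bij by (metis UNIV_I bij_betw_def imageE)
  have le: "f a \<le> f b \<longleftrightarrow> a \<le> b" if "a \<in> {1..CARD('n)}" "b \<in> {1..CARD('n)}" for a b
    using strict_mono_on_leD[OF mono] strict_mono_onD[OF mono] that by (meson linorder_not_le)
  have card: "1 \<le> CARD('n)"
    by (simp add: Suc_leI)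
  have mn: "Min UNIV = f 1"
    by (rule Min_eqI) (use surj le card in \<open>auto, metis One_nat_def atLeastAtMost_iff le order_refl\<close>)
  have mx: "Max UNIV = f CARD('n)"
    by (rule Max_eqI) (use surj le card in \<open>auto, metis One_nat_def atLeastAtMost_iff le order_refl\<close>)
  show "cyc_pred (f 1) = f CARD('n)"
    by (simp add: cyc_pred_def mn mx)
  fix k assume k: "1 \<le> k" "k < CARD('n)"
  have "f (Suc k) \<noteq> f 1"
    using le[of "Suc k" 1] k by auto
  moreover have "Max {j. j < f (Suc k)} = f k"
  proof (rule Max_eqI)
    show "f k \<in> {j. j < f (Suc k)}"
      using strict_mono_onD[OF mono, of k "Suc k"] k by auto
    fix y assume y: "y \<in> {j. j < f (Suc k)}"
    obtain l where l: "l \<in> {1..CARD('n)}" "y = f l"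
      using surj by blast
    then have "l < Suc k"
      using y le[of "Suc k" l] k by force
    then show "y \<le> f k"
      using le[of l k] l k by auto
  qed simp
  ultimately show "cyc_pred (f (Suc k)) = f k"
    by (simp add: cyc_pred_def mn)
qed

definition cyc_shift :: "'h ^ 'n::{finite,linorder} \<Rightarrow> 'h ^ 'n::{finite,linorder}" where
  "cyc_shift x = (\<chi> i. x $ cyc_pred i)"

definition shift_diff :: "'h::real_vector ^ 'n::{finite,linorder} \<Rightarrow> 'h ^ 'n::{finite,linorder}" where
  "shift_diff x = cyc_shift x - x"

definition mean_zero :: "('h::real_vector ^ 'n::{finite,linorder}) set" where
  "mean_zero = {y. (1 / real CARD('n)) *\<^sub>R (\<Sum>i=1..CARD('n). (cyc_shift ^^ i) y) = 0}"

text \<open>The constant \<open>closest_point\<close> of the library requires the Heine-Borel property and is thus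
  confined to finite dimension.\<close>

definition nearest_point :: "'h::metric_space set \<Rightarrow> 'h \<Rightarrow> 'h" where
  "nearest_point A x = (THE p. p \<in> A \<and> (\<forall>a\<in>A. dist x p \<le> dist x a))"

definition is_cycle :: "('n \<Rightarrow> 'h::metric_space set) \<Rightarrow> 'h ^ 'n::{finite,linorder} \<Rightarrow> bool" where
  "is_cycle C z \<longleftrightarrow> (\<forall>i. z $ i = nearest_point (C i) (z $ cyc_pred i))"

definition prod_set :: "('n \<Rightarrow> 'h set) \<Rightarrow> ('h ^ 'n) set" where
  "prod_set C = {x. \<forall>i. x $ i \<in> C i}"

definition support_fun :: "'a::real_inner set \<Rightarrow> 'a \<Rightarrow> ereal" where
  "support_fun A t = (SUP c\<in>A. ereal (c \<bullet> t))"

definition D_set :: "('n \<Rightarrow> 'h::real_inner set) \<Rightarrow> ('h ^ 'n::{finite,linorder}) set" where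
  "D_set C = {y \<in> mean_zero. support_fun (prod_set C) y + ereal ((1/2) * (norm y)\<^sup>2) \<le> 0}"

text \<open>In the following inequality \<open>support_fun (prod_set C) (shift_diff e)\<close> is real, because
  of the conjunct \<open>d \<in> D_set C\<close> (for nonempty sets), so that no difference of infinities occurs
  and the left-hand side is \<open>-\<infinity>\<close> if the subtracted value is \<open>\<infinity>\<close>.\<close>

definition difference_pair ::
    "('n \<Rightarrow> 'h::real_inner set) \<Rightarrow> 'h ^ 'n::{finite,linorder} \<Rightarrow> 'h ^ 'n::{finite,linorder} \<Rightarrow> bool" where
  "difference_pair C d e \<longleftrightarrow> d \<in> mean_zero \<and> e \<in> mean_zero \<and>
     (\<forall>x. support_fun (prod_set C) (shift_diff e) + ereal ((shift_diff x - shift_diff e) \<bullet> e)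
            - support_fun (prod_set C) (shift_diff x) \<le> 0) \<and>
     d = shift_diff e \<and> d \<in> D_set C"

end

theory Submission
  imports Defs
begin

text \<open>
  Since \<open>R\<close> is an isometry, \<open>\<langle>x, Sx\<rangle> = -\<parallel>Sx\<parallel>\<^sup>2 / 2\<close>.  Hence a point \<open>e\<close> of the closure \<open>K\<close> of
  the orthogonal projection of \<open>C\<close> to \<open>Y\<close> yields a pair \<open>(Se, e)\<close> as soon as it solves the
  variational inequality \<open>\<langle>Se, k - e\<rangle> \<le> 0\<close> for \<open>k \<in> K\<close>.  A solution is a fixed point of
  \<open>P\<^sub>K \<circ> (I + S/2)\<close>, which is a contraction of \<open>K\<close>: on \<open>Y\<close> the operator \<open>S\<close> is bounded below and
  \<open>\<parallel>y + Sy/2\<parallel>\<^sup>2 = \<parallel>y\<parallel>\<^sup>2 - \<parallel>Sy\<parallel>\<^sup>2 / 4\<close>.  Given a pair \<open>(d, e)\<close>, a vector \<open>z\<close> is a cycle iff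
  \<open>z \<in> C\<close> and \<open>Sz\<close> is normal to \<open>C\<close> at \<open>z\<close>; the subgradient inequality then forces
  \<open>\<langle>S(z - e), z - e\<rangle> \<ge> 0\<close>, that is, \<open>Sz = Se = d\<close>.
\<close>

section \<open>Nearest points in Hilbert space\<close>

text \<open>The near-minimizers of the squared distance form nested nonempty closed sets. By the
  parallelogram law their diameters tend to 0, so completeness gives a common point, and it attains
  the infimum.\<close>

lemma nearest_point_exists:
  fixes A :: "'a::{real_inner,banach} set"
  assumes "A \<noteq> {}" "closed A" "convex A"
  shows "\<exists>p\<in>A. \<forall>a\<in>A. dist x p \<le> dist x a"
proof -
  define \<delta> where "\<delta> = (INF a\<in>A. (dist x a)\<^sup>2)"
  have bdd: "bdd_below ((\<lambda>a. (dist x a)\<^sup>2) ` A)"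
    by (rule bdd_belowI2[of _ 0]) simp
  have \<delta>: "\<delta> \<le> (dist x a)\<^sup>2" if "a \<in> A" for a
    unfolding \<delta>_def using bdd that by (rule cINF_lower)
  define B where "B n = {a \<in> A. (dist x a)\<^sup>2 \<le> \<delta> + 1 / real (Suc n)}" for n
  have "closed (B n)" for n
  proof -
    have "B n = A \<inter> {a. (dist x a)\<^sup>2 \<le> \<delta> + 1 / real (Suc n)}"
      by (auto simp: B_def)
    moreover have "closed {a. (dist x a)\<^sup>2 \<le> \<delta> + 1 / real (Suc n)}"
      by (intro closed_Collect_le continuous_intros)
    ultimately show ?thesis
      using assms(2) by auto
  qed
  moreover have "B n \<noteq> {}" for n
  proof -
    have "\<delta> < \<delta> + 1 / real (Suc n)"
      by simp
    then obtain a where "a \<in> A" "(dist x a)\<^sup>2 < \<delta> + 1 / real (Suc n)"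
      unfolding \<delta>_def cINF_less_iff[OF assms(1) bdd] by blast
    then show ?thesis
      by (auto simp: B_def intro: less_imp_le)
  qed
  moreover have "B n \<subseteq> B m" if "m \<le> n" for m n
  proof -
    have "1 / real (Suc n) \<le> 1 / real (Suc m)"
      using that by (simp add: frac_le)
    then show ?thesis
      by (force simp: B_def)
  qed
  moreover have "\<exists>n. \<forall>a\<in>B n. \<forall>b\<in>B n. dist a b < \<epsilon>" if "\<epsilon> > 0" for \<epsilon>
  proof -
    \<comment> \<open>For \<open>a\<close>, \<open>b\<close> in \<open>B n\<close> the parallelogram
      law below gives \<open>(dist a b)^2 <= 4 / (n + 1)\<close>, because the midpoint lies in
      \<open>A\<close> and so has squared distance at least \<open>\<delta>\<close> from
      \<open>x\<close>. Hence the factor 1/4.\<close>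
    have "0 < \<epsilon>\<^sup>2 / 4"
      using that by simp
    then obtain n where n: "inverse (real (Suc n)) < \<epsilon>\<^sup>2 / 4"
      using reals_Archimedean by blast
    have "dist a b < \<epsilon>" if ab: "a \<in> B n" "b \<in> B n" for a b
    proof -
      let ?c = "(1/2) *\<^sub>R a + (1/2) *\<^sub>R b"
      have "?c \<in> A"
        using ab assms(3) by (intro convexD) (auto simp: B_def)
      then have "\<delta> \<le> (dist x ?c)\<^sup>2"
        by (rule \<delta>)
      moreover have "(dist a b)\<^sup>2 = 2 * (dist x a)\<^sup>2 + 2 * (dist x b)\<^sup>2 - 4 * (dist x ?c)\<^sup>2"
        by (simp add: dist_norm power2_norm_eq_inner algebra_simps inner_commute)
      moreover have "(dist x a)\<^sup>2 \<le> \<delta> + inverse (real (Suc n))"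
        "(dist x b)\<^sup>2 \<le> \<delta> + inverse (real (Suc n))"
        using ab by (auto simp: B_def inverse_eq_divide)
      ultimately have "(dist a b)\<^sup>2 < \<epsilon>\<^sup>2"
        using n by linarith
      then show ?thesis
        using \<open>\<epsilon> > 0\<close> by (simp add: power_less_imp_less_base)
    qed
    then show ?thesis
      by blast
  qed
  ultimately obtain p where p: "\<And>n. p \<in> B n"
    using decreasing_closed_nest[of B] by metis
  have le: "(dist x p)\<^sup>2 \<le> \<delta>"
  proof (rule ccontr)
    assume "\<not> ?thesis"
    then obtain n where "inverse (real (Suc n)) < (dist x p)\<^sup>2 - \<delta>"
      using reals_Archimedean[of "(dist x p)\<^sup>2 - \<delta>"] by auto
    with p[of n] show False
      by (auto simp: B_def inverse_eq_divide)
  qed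
  show ?thesis
  proof (intro bexI[of _ p] ballI)
    show "p \<in> A"
      using p by (auto simp: B_def)
    show "dist x p \<le> dist x a" if "a \<in> A" for a
      by (rule power2_le_imp_le[OF order_trans[OF le \<delta>[OF that]]]) simp
  qed
qed

text \<open>This obtuse-angle criterion replaces the definite description in
  \<open>nearest_point\<close>: existence and uniqueness make the description denote, and expanding
  the square turns minimality into an inequality of inner products.\<close>

lemma nearest_point_iff:
  fixes A :: "'a::{real_inner,banach} set"
  assumes "A \<noteq> {}" "closed A" "convex A"
  shows "p = nearest_point A x \<longleftrightarrow> p \<in> A \<and> (\<forall>a\<in>A. (x - p) \<bullet> (a - p) \<le> 0)"
proof -
  let ?N = "\<lambda>p. p \<in> A \<and> (\<forall>a\<in>A. dist x p \<le> dist x a)"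
  have N: "?N p \<longleftrightarrow> p \<in> A \<and> (\<forall>a\<in>A. (x - p) \<bullet> (a - p) \<le> 0)" for p
  proof (intro iffI conjI ballI; (elim conjE)?)
    show "dist x p \<le> dist x a" if "\<forall>a\<in>A. (x - p) \<bullet> (a - p) \<le> 0" "a \<in> A" for a
    proof (rule power2_le_imp_le)
      have "(dist x a)\<^sup>2 = (dist x p)\<^sup>2 - 2 * ((x - p) \<bullet> (a - p)) + (dist p a)\<^sup>2"
        by (simp add: dist_norm power2_norm_eq_inner algebra_simps inner_commute)
      moreover have "(x - p) \<bullet> (a - p) \<le> 0"
        using that by blast
      ultimately show "(dist x p)\<^sup>2 \<le> (dist x a)\<^sup>2"
        using zero_le_power2[of "dist p a"] by linarith
    qed simp
  qed (use any_closest_point_dot[OF assms(3,2)] in auto)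
  obtain q where q: "?N q"
    using nearest_point_exists[OF assms] by blast
  have uniq: "p = q" if "?N p" for p
    using any_closest_point_unique[OF assms(3,2)] that q by blast
  have "nearest_point A x = q"
    unfolding nearest_point_def using q uniq by (intro the_equality)
  then show ?thesis
    using q uniq N by blast
qed

text \<open>Adding the obtuse-angle inequalities at p and q gives <x - y, p - q> >= |p - q|^2;
  combined with |(x - y) - (p - q)|^2 >= 0 this bounds |p - q| by |x - y|.\<close>

lemma nearest_point_nonexpansive:
  fixes A :: "'a::{real_inner,banach} set"
  assumes "A \<noteq> {}" "closed A" "convex A"
  shows "dist (nearest_point A x) (nearest_point A y) \<le> dist x y"
proof -
  let ?p = "nearest_point A x" and ?q = "nearest_point A y"
  have "(x - ?p) \<bullet> (?q - ?p) \<le> 0" "(y - ?q) \<bullet> (?p - ?q) \<le> 0"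
    using nearest_point_iff[OF assms] by blast+
  then show ?thesis
    unfolding dist_norm norm_le
    using inner_ge_zero[of "(x - ?p) - (y - ?q)"]
    by (simp add: inner_add inner_diff inner_commute)
qed

text \<open>Projecting after \<open>g\<close> is a contraction of the complete set \<open>A\<close>.
  Its fixed point is the nearest point of \<open>A\<close> to \<open>g e\<close>, and the
  obtuse-angle criterion for it is the variational inequality.\<close>

lemma variational_inequality_solution:
  fixes A :: "'a::{real_inner,banach} set"
  assumes A: "A \<noteq> {}" "closed A" "convex A"
    and c: "0 \<le> c" "c < 1"
    and g: "\<And>x y. x \<in> A \<Longrightarrow> y \<in> A \<Longrightarrow> dist (g x) (g y) \<le> c * dist x y"
  shows "\<exists>e\<in>A. \<forall>a\<in>A. (g e - e) \<bullet> (a - e) \<le> 0"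
proof -
  let ?f = "\<lambda>x. nearest_point A (g x)"
  have "\<exists>!e. e \<in> A \<and> ?f e = e"
  proof (rule Banach_fix)
    show "complete A"
      using A by (simp add: complete_eq_closed)
    show "?f ` A \<subseteq> A"
      using nearest_point_iff[OF A] by blast
    show "dist (?f x) (?f y) \<le> c * dist x y" if "x \<in> A" "y \<in> A" for x y
      using nearest_point_nonexpansive[OF A] g[OF that] order_trans by blast
  qed (use A c in auto)
  then show ?thesis
    using nearest_point_iff[OF A] by metis
qed

section \<open>The cyclic shift\<close>

lemma cyc_pred_funpow_enum:
  fixes f :: "nat \<Rightarrow> 'n::{finite,linorder}"
  assumes "bij_betw f {1..CARD('n)} UNIV" "strict_mono_on {1..CARD('n)} f" "k < CARD('n)"
  shows "(cyc_pred ^^ k) (f CARD('n)) = f (CARD('n) - k)"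
  using assms(3)
proof (induction k)
  case (Suc k)
  then have "CARD('n) - k = Suc (CARD('n) - Suc k)"
    by simp
  with Suc show ?case
    using cyc_pred_enum(2)[OF assms(1,2), of "CARD('n) - Suc k"] by simp
qed simp

text \<open>From the index m the iterates descend m, m-1, ..., 1 and then return to m. This yields a
  reindexing of sums by iterates, the period m, and an induction downwards from m.\<close>

lemma cyc_pred_orbit:
  shows bij_betw_cyc_pred_orbit:
      "bij_betw (\<lambda>k. (cyc_pred ^^ k) (Max UNIV)) {..<CARD('n)} (UNIV :: 'n::{finite,linorder} set)"
    and cyc_pred_funpow_card: "(cyc_pred ^^ CARD('n)) (i::'n) = i"
    and cyc_pred_induct: "P (Max UNIV) \<Longrightarrow> (\<And>i. P i \<Longrightarrow> i \<noteq> Min UNIV \<Longrightarrow> P (cyc_pred i)) \<Longrightarrow> P i"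
proof -
  let ?m = "CARD('n)"
  let ?xs = "sorted_list_of_set (UNIV :: 'n set)"
  define f where "f k = ?xs ! (k - 1)" for k
  have "bij_betw (\<lambda>k. k - 1) {1..?m} {..<?m}"
    by (rule bij_betwI[of _ _ _ Suc]) auto
  moreover have "bij_betw ((!) ?xs) {..<?m} UNIV"
    using bij_betw_nth[of ?xs "{..<?m}" UNIV] by simp
  ultimately have bij: "bij_betw f {1..?m} UNIV"
    using bij_betw_trans unfolding f_def[abs_def] comp_def by blast
  have mono: "strict_mono_on {1..?m} f"
    unfolding f_def
    by (intro strict_mono_onI sorted_wrt_nth_less[of "(<)"])
       (auto simp: strict_sorted_list_of_set)
  have "1 \<le> ?m"
    by (simp add: Suc_leI)
  have le: "f a \<le> f b" if "a \<in> {1..?m}" "b \<in> {1..?m}" "a \<le> b" for a b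
    using strict_mono_on_leD[OF mono] that by blast
  have surj: "\<exists>k\<in>{1..?m}. i = f k" for i
    using bij by (metis UNIV_I bij_betw_def imageE)
  have mx: "Max UNIV = f ?m"
    using surj le \<open>1 \<le> ?m\<close> by (intro Max_eqI) (auto, metis atLeastAtMost_iff order_refl)
  have mn: "Min UNIV = f 1"
    using surj le \<open>1 \<le> ?m\<close> by (intro Min_eqI) (auto, metis One_nat_def atLeastAtMost_iff order_refl)
  have orbit: "(cyc_pred ^^ k) (Max UNIV) = f (?m - k)" if "k < ?m" for k
    using cyc_pred_funpow_enum[OF bij mono that] by (simp add: mx)
  have "bij_betw (\<lambda>k. ?m - k) {..<?m} {1..?m}"
    by (rule bij_betwI[of _ _ _ "\<lambda>k. ?m - k"]) auto
  then have "bij_betw (\<lambda>k. f (?m - k)) {..<?m} UNIV"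
    using bij_betw_trans[OF _ bij] by (fastforce simp: comp_def)
  then show bij': "bij_betw (\<lambda>k. (cyc_pred ^^ k) (Max UNIV)) {..<?m} (UNIV :: 'n set)"
    by (subst bij_betw_cong[of _ _ "\<lambda>k. f (?m - k)"]) (auto simp: orbit)
  have "i \<in> (\<lambda>k. (cyc_pred ^^ k) (Max UNIV)) ` {..<?m}"
    using bij' by (simp add: bij_betw_def)
  then obtain k where k: "i = (cyc_pred ^^ k) (Max UNIV)"
    by blast
  have "(cyc_pred ^^ ?m) (Max UNIV) = cyc_pred ((cyc_pred ^^ (?m - 1)) (Max UNIV :: 'n))"
    using \<open>1 \<le> ?m\<close> by (cases "?m") auto
  also have "\<dots> = Max UNIV"
    using orbit[of "?m - 1"] cyc_pred_enum(1)[OF bij mono] \<open>1 \<le> ?m\<close> by (simp add: mx)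
  finally have mx_period: "(cyc_pred ^^ ?m) (Max UNIV :: 'n) = Max UNIV" .
  \<comment> \<open>Iterates commute, so the period found at m carries over to every point of its
    orbit.\<close>
  have "(cyc_pred ^^ ?m) i = (cyc_pred ^^ (?m + k)) (Max UNIV)"
    by (simp add: k funpow_add)
  also have "\<dots> = (cyc_pred ^^ (k + ?m)) (Max UNIV)"
    by (simp only: add.commute)
  finally show "(cyc_pred ^^ ?m) i = i"
    by (simp add: funpow_add mx_period k)
  show "P i" if "P (Max UNIV)" and step: "\<And>i. P i \<Longrightarrow> i \<noteq> Min UNIV \<Longrightarrow> P (cyc_pred i)"
  proof -
    have "P (f (?m - k))" if "k < ?m" for k
      using that
    proof (induction k)
      case 0
      then show ?case
        using \<open>P (Max UNIV)\<close> by (simp add: mx)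
    next
      case (Suc k)
      then have "f (?m - k) \<noteq> f 1"
        using bij by (auto simp: bij_betw_def inj_on_eq_iff)
      then have "P (cyc_pred (f (?m - k)))"
        using Suc step mn by auto
      moreover have "?m - k = Suc (?m - Suc k)"
        using Suc.prems by simp
      ultimately show ?case
        using Suc.prems cyc_pred_enum(2)[OF bij mono, of "?m - Suc k"] by simp
    qed
    moreover obtain l where "l \<in> {1..?m}" "i = f l"
      using surj by blast
    ultimately show ?thesis
      by (metis atLeastAtMost_iff diff_diff_cancel diff_less less_le_trans zero_less_one zero_less_card_finite)
  qed
qed

lemma bij_cyc_pred: "bij (cyc_pred :: 'n::{finite,linorder} \<Rightarrow> 'n)"
proof -
  have "cyc_pred ((cyc_pred ^^ (CARD('n) - 1)) i) = i" for i :: 'n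
    using cyc_pred_funpow_card[of i] by (cases "CARD('n)") auto
  then have "surj (cyc_pred :: 'n \<Rightarrow> 'n)"
    by (rule surjI)
  then show ?thesis
    by (simp add: bij_def finite_UNIV_surj_inj)
qed

lemma cyc_pred_Min: "cyc_pred (Min UNIV) = Max UNIV"
  by (simp add: cyc_pred_def)

text \<open>No index lies strictly between \<open>cyc_pred i\<close> and \<open>i\<close>. This is
  the recursion for the translation vectors in the intersection formula.\<close>

lemma sum_atLeastLessThan_cyc_pred:
  fixes f :: "'n::{finite,linorder} \<Rightarrow> 'a::comm_monoid_add"
  assumes "i \<noteq> Min UNIV"
  shows "sum f {cyc_pred i..<Max UNIV} = f (cyc_pred i) + sum f {i..<Max UNIV}"
proof -
  have "Min UNIV < i"
    using assms by (simp add: order_less_le)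
  then have "Max {j. j < i} \<in> {j. j < i}"
    by (intro Max_in) auto
  then have lt: "cyc_pred i < i"
    using assms by (simp add: cyc_pred_def)
  have "j \<le> cyc_pred i" if "j < i" for j
    using assms that by (simp add: cyc_pred_def)
  then have "cyc_pred i \<le> j \<longleftrightarrow> j = cyc_pred i \<or> i \<le> j" for j
    using lt by (metis leI less_imp_le order.antisym order.refl order.trans)
  moreover have "cyc_pred i < Max UNIV"
    using lt Max_ge[of UNIV i] by (simp add: order.strict_trans2)
  ultimately have "{cyc_pred i..<Max UNIV} = insert (cyc_pred i) {i..<Max UNIV}"
    by auto
  moreover have "cyc_pred i \<notin> {i..<Max UNIV}"
    using lt by auto
  ultimately show ?thesis
    by simp
qed

section \<open>The operators R and S in coordinates\<close>

lemma cyc_shift_nth [simp]: "cyc_shift x $ i = x $ cyc_pred i"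
  by (simp add: cyc_shift_def)

lemma shift_diff_nth: "shift_diff x $ i = x $ cyc_pred i - x $ i"
  by (simp add: shift_diff_def)

lemma shift_diff_diff: "shift_diff (x - y) = shift_diff x - shift_diff y"
  by (simp add: vec_eq_iff shift_diff_nth)

lemma cyc_shift_funpow_nth: "(cyc_shift ^^ k) x $ i = x $ (cyc_pred ^^ k) i"
proof (induction k arbitrary: i)
  case (Suc k)
  have "(cyc_shift ^^ Suc k) x $ i = x $ (cyc_pred ^^ k) (cyc_pred i)"
    by (simp add: Suc)
  then show ?case
    by (simp add: funpow_swap1)
qed simp

lemma sum_cyc_pred:
  "(\<Sum>i\<in>UNIV. f (cyc_pred i)) = (\<Sum>i\<in>(UNIV :: 'n::{finite,linorder} set). f i)"
  using sum.reindex_bij_betw[OF bij_cyc_pred] .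

text \<open>Component j of the sum of the shifts runs over one full period of
  \<open>cyc_pred\<close> from j. It is therefore independent of j, and at j = m it is the sum of
  all entries.\<close>

lemma mean_zero_iff:
  fixes y :: "'h::real_vector ^ 'n::{finite,linorder}"
  shows "y \<in> mean_zero \<longleftrightarrow> (\<Sum>i\<in>UNIV. y $ i) = 0"
proof -
  let ?m = "CARD('n)"
  define T where "T j = (\<Sum>i=1..?m. y $ (cyc_pred ^^ i) j)" for j
  have T_pred: "T (cyc_pred j) = T j" for j
  proof -
    define g where "g i = y $ (cyc_pred ^^ i) j" for i
    have "T (cyc_pred j) = (\<Sum>i=1..?m. g (Suc i))"
      by (simp add: T_def g_def funpow_swap1)
    also have "\<dots> = (\<Sum>i=Suc 1..Suc ?m. g i)"
      by (simp only: sum.shift_bounds_cl_Suc_ivl)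
    \<comment> \<open>Moving the window of exponents from 1..m to 2..m+1 trades \<open>g 1\<close>
      for \<open>g (m + 1)\<close>, and these agree by periodicity.\<close>
    finally have "g 1 + T (cyc_pred j) = (\<Sum>i=1..Suc ?m. g i)"
      using sum.atLeast_Suc_atMost[of 1 "Suc ?m" g] by simp
    also have "\<dots> = T j + g (Suc ?m)"
      by (simp add: T_def g_def)
    also have "g (Suc ?m) = g 1"
      by (simp add: g_def cyc_pred_funpow_card)
    finally show ?thesis
      by simp
  qed
  have T: "T j = (\<Sum>i\<in>UNIV. y $ i)" for j
  proof (rule cyc_pred_induct[of "\<lambda>j. T j = (\<Sum>i\<in>UNIV. y $ i)"])
    have "(\<Sum>i\<in>UNIV. y $ i) = (\<Sum>k<?m. y $ (cyc_pred ^^ k) (Max UNIV))"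
      using sum.reindex_bij_betw[OF bij_betw_cyc_pred_orbit, of "($) y"] by simp
    \<comment> \<open>The extra \<open>cyc_pred\<close> moves the exponents from 0..m-1 to the range
      1..m used in \<open>T\<close>.\<close>
    also have "\<dots> = (\<Sum>i\<in>UNIV. y $ (cyc_pred i))"
      using sum_cyc_pred[of "($) y"] sum.reindex_bij_betw[OF bij_betw_cyc_pred_orbit, of "($) y"] by simp
    also have "\<dots> = (\<Sum>k<?m. y $ (cyc_pred ^^ Suc k) (Max UNIV))"
      using sum.reindex_bij_betw[OF bij_betw_cyc_pred_orbit, of "\<lambda>i. y $ cyc_pred i"] by simp
    also have "\<dots> = T (Max UNIV)"
      unfolding T_def by (rule sum.reindex_bij_witness[of _ "\<lambda>i. i - 1" Suc]) auto
    finally show "T (Max UNIV) = (\<Sum>i\<in>UNIV. y $ i)" ..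
  qed (simp add: T_pred)
  have "y \<in> mean_zero \<longleftrightarrow> (\<Sum>i=1..?m. (cyc_shift ^^ i) y) = 0"
    by (simp add: mean_zero_def)
  also have "\<dots> \<longleftrightarrow> (\<forall>j. T j = 0)"
    by (simp add: vec_eq_iff T_def cyc_shift_funpow_nth)
  finally show ?thesis
    by (simp add: T)
qed

lemma shift_diff_mean_zero: "shift_diff x \<in> mean_zero"
  by (simp add: mean_zero_iff shift_diff_nth sum_subtractf sum_cyc_pred)

section \<open>Norm estimates for S\<close>

lemma inner_cyc_shift:
  "cyc_shift x \<bullet> cyc_shift y = x \<bullet> (y :: 'h::real_inner ^ 'n::{finite,linorder})"
  using sum_cyc_pred[of "\<lambda>i. x $ i \<bullet> y $ i"] by (simp add: inner_vec_def)

lemma inner_shift_diff: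
  fixes x :: "'h::real_inner ^ 'n::{finite,linorder}"
  shows "x \<bullet> shift_diff x = - (1/2) * (norm (shift_diff x))\<^sup>2"
  by (simp add: shift_diff_def power2_norm_eq_inner inner_diff inner_cyc_shift inner_commute[of "cyc_shift x" x] field_simps)

text \<open>A discrete Poincare inequality. Each step along the orbit changes the entry of
  \<open>y\<close> by a component of \<open>Sy\<close>, so all entries are within m |Sy| of the last
  one. The vanishing sum bounds the last entry, so every entry has norm at most 2m |Sy|; adding m
  such bounds gives the constant.\<close>

lemma shift_diff_bounded_below:
  fixes y :: "'h::real_inner ^ 'n::{finite,linorder}"
  assumes "y \<in> mean_zero"
  shows "norm y \<le> 2 * (real CARD('n))\<^sup>2 * norm (shift_diff y)"
proof -
  let ?m = "real CARD('n)" and ?s = "norm (shift_diff y)" and ?M = "Max UNIV :: 'n"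
  have walk: "norm (y $ (cyc_pred ^^ k) ?M - y $ ?M) \<le> real k * ?s" for k
  proof (induction k)
    case (Suc k)
    let ?i = "(cyc_pred ^^ k) ?M"
    have "norm (y $ cyc_pred ?i - y $ ?i) \<le> ?s"
      using Finite_Cartesian_Product.norm_nth_le[of "shift_diff y" ?i] by (simp add: shift_diff_nth)
    then have "norm ((y $ cyc_pred ?i - y $ ?i) + (y $ ?i - y $ ?M)) \<le> ?s + real k * ?s"
      using Suc by (intro order_trans[OF norm_triangle_ineq] add_mono)
    then show ?case
      by (simp add: algebra_simps)
  qed simp
  have osc: "norm (y $ i - y $ ?M) \<le> ?m * ?s" for i
  proof -
    have "i \<in> (\<lambda>k. (cyc_pred ^^ k) ?M) ` {..<CARD('n)}"
      using bij_betw_cyc_pred_orbit[where 'n='n] by (simp add: bij_betw_def)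
    then obtain k where k: "k < CARD('n)" "i = (cyc_pred ^^ k) ?M"
      by blast
    have "real k * ?s \<le> ?m * ?s"
      using k(1) by (intro mult_right_mono) auto
    with walk[of k] show ?thesis
      unfolding k(2) by linarith
  qed
  have "?m *\<^sub>R (y $ ?M) = - (\<Sum>i\<in>UNIV. y $ i - y $ ?M)"
    using assms by (simp add: mean_zero_iff sum_subtractf sum_constant_scaleR)
  also have "norm \<dots> \<le> (\<Sum>i\<in>UNIV. norm (y $ i - y $ ?M))"
    unfolding norm_minus_cancel by (rule norm_sum)
  also have "\<dots> \<le> ?m * (?m * ?s)"
    using sum_bounded_above[of UNIV "\<lambda>i. norm (y $ i - y $ ?M)" "?m * ?s"] osc by simp
  finally have "norm (y $ ?M) \<le> ?m * ?s"
    by simp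
  then have "norm (y $ i) \<le> 2 * ?m * ?s" for i
    using osc[of i] norm_triangle_sub[of "y $ i" "y $ ?M"] by simp
  then have "(\<Sum>i\<in>UNIV. norm (y $ i)) \<le> ?m * (2 * ?m * ?s)"
    using sum_bounded_above[of UNIV "\<lambda>i. norm (y $ i)" "2 * ?m * ?s"] by simp
  moreover have "norm y \<le> (\<Sum>i\<in>UNIV. norm (y $ i))"
    by (simp add: norm_vec_def L2_set_le_sum)
  ultimately show ?thesis
    by (simp add: power2_eq_square)
qed

lemma averaged_shift_contraction:
  "\<exists>c. 0 \<le> c \<and> c < 1 \<and> (\<forall>y \<in> (mean_zero :: ('h::real_inner ^ 'n::{finite,linorder}) set).
     norm (y + (1/2) *\<^sub>R shift_diff y) \<le> c * norm y)"
proof -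
  define K where "K = 2 * (real CARD('n))\<^sup>2"
  have "1 \<le> real CARD('n)"
    by (simp add: Suc_leI)
  then have K: "1 \<le> K"
    using one_le_power[of "real CARD('n)" 2] unfolding K_def by linarith
  \<comment> \<open>Insert |Sy| >= |y| / K into |y + Sy/2|^2 = |y|^2 - |Sy|^2 / 4.\<close>
  define c where "c = sqrt (1 - 1 / (4 * K\<^sup>2))"
  have "1 \<le> K\<^sup>2"
    using K by simp
  then have "0 < 1 / (4 * K\<^sup>2)" "1 / (4 * K\<^sup>2) \<le> 1"
    by (auto simp: divide_simps)
  then have c: "0 \<le> c" "c < 1" "c\<^sup>2 = 1 - 1 / (4 * K\<^sup>2)"
    by (auto simp: c_def)
  have "norm (y + (1/2) *\<^sub>R shift_diff y) \<le> c * norm y"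
    if "y \<in> mean_zero" for y :: "'h ^ 'n::{finite,linorder}"
  proof (rule power2_le_imp_le)
    have "(norm y)\<^sup>2 \<le> (K * norm (shift_diff y))\<^sup>2"
      unfolding K_def using shift_diff_bounded_below[OF that] by (intro power_mono) auto
    then have "(norm y)\<^sup>2 / (4 * K\<^sup>2) \<le> (norm (shift_diff y))\<^sup>2 / 4"
      using \<open>1 \<le> K\<^sup>2\<close> by (simp add: divide_simps power_mult_distrib mult.commute)
    moreover have "(norm (y + (1/2) *\<^sub>R shift_diff y))\<^sup>2
        = (norm y)\<^sup>2 + y \<bullet> shift_diff y + (norm (shift_diff y))\<^sup>2 / 4"
      unfolding power2_norm_eq_inner by (simp add: inner_add inner_commute)
    ultimately show "(norm (y + (1/2) *\<^sub>R shift_diff y))\<^sup>2 \<le> (c * norm y)\<^sup>2"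
      by (simp add: inner_shift_diff power_mult_distrib c(3) algebra_simps)
  qed (use c in simp)
  with c show ?thesis
    by blast
qed

section \<open>Existence of the difference pair\<close>

text \<open>The orthogonal projection onto \<open>mean_zero\<close>: the subtracted vector has equal
  entries and is orthogonal to that subspace.\<close>

definition center :: "'h::real_vector ^ 'n::finite \<Rightarrow> 'h ^ 'n" where
  "center x = x - (\<chi> i. (1 / real CARD('n)) *\<^sub>R (\<Sum>j\<in>UNIV. x $ j))"

lemma linear_center: "linear center"
  by (rule linearI)
     (simp_all add: center_def vec_eq_iff sum.distrib scaleR_right_distrib scaleR_sum_right
       scaleR_right_diff_distrib mult.commute)

lemma center_mean_zero: "center x \<in> mean_zero"
  by (simp add: mean_zero_iff center_def sum_subtractf sum_constant_scaleR)

lemma inner_center: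
  fixes x y :: "'h::real_inner ^ 'n::{finite,linorder}"
  assumes "y \<in> mean_zero"
  shows "center x \<bullet> y = x \<bullet> y"
proof -
  have "(\<chi> i. a) \<bullet> y = a \<bullet> (\<Sum>i\<in>UNIV. y $ i)" for a :: 'h
    by (simp add: inner_vec_def inner_sum_right)
  then show ?thesis
    using assms by (simp add: center_def inner_diff_left mean_zero_iff)
qed

lemma closed_mean_zero: "closed (mean_zero :: ('h::real_normed_vector ^ 'n::{finite,linorder}) set)"
proof -
  have "mean_zero = {y :: 'h ^ 'n::{finite,linorder}. (\<Sum>i\<in>UNIV. y $ i) = 0}"
    by (auto simp: mean_zero_iff)
  moreover have "closed {y :: 'h ^ 'n::{finite,linorder}. (\<Sum>i\<in>UNIV. y $ i) = 0}"
    by (intro closed_Collect_eq continuous_intros)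
  ultimately show ?thesis
    by simp
qed

lemma prod_set_nonempty: "(\<And>i. C i \<noteq> {}) \<Longrightarrow> prod_set C \<noteq> {}"
  by (auto simp: prod_set_def intro!: exI[of _ "\<chi> i. SOME c. c \<in> C i"] some_in_eq[THEN iffD2])

lemma convex_prod_set: "(\<And>i. convex (C i)) \<Longrightarrow> convex (prod_set C)"
  by (auto simp: prod_set_def convex_def)

lemma support_fun_upper: "c \<in> A \<Longrightarrow> ereal (c \<bullet> t) \<le> support_fun A t"
  unfolding support_fun_def by (rule SUP_upper)

lemma support_fun_le_iff: "support_fun A t \<le> b \<longleftrightarrow> (\<forall>c\<in>A. ereal (c \<bullet> t) \<le> b)"
  unfolding support_fun_def by (rule SUP_le_iff)

text \<open>Nonemptiness excludes the value -infinity and the real bound excludes +infinity, so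
  later estimates can be carried out with real numbers.\<close>

lemma support_fun_finite:
  assumes "A \<noteq> {}" "support_fun A t \<le> ereal b"
  obtains s where "support_fun A t = ereal s" "s \<le> b" "\<And>c. c \<in> A \<Longrightarrow> c \<bullet> t \<le> s"
proof -
  obtain c where "ereal (c \<bullet> t) \<le> support_fun A t"
    using assms(1) support_fun_upper by blast
  with assms(2) obtain s where s: "support_fun A t = ereal s"
    by (cases "support_fun A t") auto
  show thesis
    using that[OF s] assms(2) support_fun_upper[of _ A t] by (auto simp: s)
qed

text \<open>The variational inequality gives sigma_C(Se) <= <e, Se>, and membership of e in
  \<open>K\<close> gives <e, Sx> <= sigma_C(Sx) for every x. The subgradient inequality follows from
  both, membership in \<open>D_set\<close> from the first.\<close>

lemma difference_pair_exists:
  fixes C :: "'n::{finite,linorder} \<Rightarrow> 'h::{real_inner,banach} set"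
  assumes "\<And>j. C j \<noteq> {}" "\<And>j. convex (C j)"
  shows "\<exists>d e. difference_pair C d e"
proof -
  let ?P = "prod_set C"
  \<comment> \<open>The projection of a closed convex set can fail to be closed, so \<open>e\<close>
    may be only a limit of projected points of the product.\<close>
  define K where "K = closure (center ` ?P)"
  have ne: "?P \<noteq> {}"
    using assms by (simp add: prod_set_nonempty)
  have K: "K \<noteq> {}" "closed K" "convex K"
    using ne convex_linear_image[OF linear_center convex_prod_set[of C]] assms(2)
    by (auto simp: K_def convex_closure)
  have K_mz: "K \<subseteq> mean_zero"
    unfolding K_def by (intro closure_minimal closed_mean_zero) (auto simp: center_mean_zero)
  obtain c where c: "0 \<le> c" "c < 1"
    and contr: "\<And>y :: 'h ^ 'n::{finite,linorder}. y \<in> mean_zero \<Longrightarrow> norm (y + (1/2) *\<^sub>R shift_diff y) \<le> c * norm y"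
    using averaged_shift_contraction by blast
  \<comment> \<open>With g = I + S/2 the vector g e - e is Se/2, a positive multiple of the vector
    wanted.\<close>
  have "\<exists>e\<in>K. \<forall>a\<in>K. ((e + (1/2) *\<^sub>R shift_diff e) - e) \<bullet> (a - e) \<le> 0"
  proof (rule variational_inequality_solution[OF K c])
    fix x y assume "x \<in> K" "y \<in> K"
    then have "x - y \<in> mean_zero"
      using K_mz by (auto simp: mean_zero_iff sum_subtractf subset_iff)
    from contr[OF this] show "dist (x + (1/2) *\<^sub>R shift_diff x) (y + (1/2) *\<^sub>R shift_diff y) \<le> c * dist x y"
      by (simp add: dist_norm shift_diff_diff algebra_simps)
  qed
  then obtain e where e: "e \<in> K" and vi: "\<And>a. a \<in> K \<Longrightarrow> shift_diff e \<bullet> (a - e) \<le> 0"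
    by auto
  have inner_K: "\<exists>k\<in>K. p \<bullet> shift_diff x = k \<bullet> shift_diff x" if "p \<in> ?P" for p x
    using that closure_subset[of "center ` ?P"] inner_center[OF shift_diff_mean_zero]
    unfolding K_def by (metis image_eqI subsetD)
  have "support_fun ?P (shift_diff e) \<le> ereal (e \<bullet> shift_diff e)"
    unfolding support_fun_le_iff
  proof
    fix p assume "p \<in> ?P"
    then obtain k where "k \<in> K" "p \<bullet> shift_diff e = k \<bullet> shift_diff e"
      using inner_K by blast
    then show "ereal (p \<bullet> shift_diff e) \<le> ereal (e \<bullet> shift_diff e)"
      using vi[of k] by (simp add: inner_diff_right inner_commute)
  qed
  then obtain s where s: "support_fun ?P (shift_diff e) = ereal s" "s \<le> e \<bullet> shift_diff e"
    using support_fun_finite[OF ne] by blast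
  have sub: "support_fun ?P (shift_diff e) + ereal ((shift_diff x - shift_diff e) \<bullet> e)
      - support_fun ?P (shift_diff x) \<le> 0" for x
  proof (cases "support_fun ?P (shift_diff x) = \<infinity>")
    case False
    then have "support_fun ?P (shift_diff x) \<le> ereal (real_of_ereal (support_fun ?P (shift_diff x)))"
      by (cases "support_fun ?P (shift_diff x)") auto
    then obtain t where t: "support_fun ?P (shift_diff x) = ereal t"
      and ub: "\<And>p. p \<in> ?P \<Longrightarrow> p \<bullet> shift_diff x \<le> t"
      using support_fun_finite[OF ne] by metis
    \<comment> \<open>The closed half-space contains the product, hence its projection, since Sx has
      mean zero, and hence the closure \<open>K\<close>.\<close>
    have "closed {k. k \<bullet> shift_diff x \<le> t}"
      by (intro closed_Collect_le continuous_intros)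
    then have "K \<subseteq> {k. k \<bullet> shift_diff x \<le> t}"
      unfolding K_def using ub by (intro closure_minimal) (auto simp: inner_center shift_diff_mean_zero)
    then have "e \<bullet> shift_diff x \<le> t"
      using e by blast
    then show ?thesis
      using s by (simp add: t inner_diff_left inner_commute[of _ e] algebra_simps)
  qed (simp add: s)
  have "s + (1/2) * (norm (shift_diff e))\<^sup>2 \<le> 0"
    using s(2) by (simp add: inner_shift_diff)
  then have "shift_diff e \<in> D_set C"
    by (simp add: D_set_def shift_diff_mean_zero s)
  then have "difference_pair C (shift_diff e) e"
    using sub e K_mz by (auto simp: difference_pair_def shift_diff_mean_zero)
  then show ?thesis
    by blast
qed

section \<open>Cycles\<close>

text \<open>The obtuse-angle inequalities of the m coordinates add up to the inequality on the
  product; varying one coordinate at a time recovers them.\<close>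

lemma is_cycle_iff_normal:
  fixes C :: "'n::{finite,linorder} \<Rightarrow> 'h::{real_inner,banach} set"
  assumes "\<And>j. C j \<noteq> {}" "\<And>j. closed (C j)" "\<And>j. convex (C j)"
  shows "is_cycle C z \<longleftrightarrow> z \<in> prod_set C \<and> (\<forall>c\<in>prod_set C. shift_diff z \<bullet> (c - z) \<le> 0)"
    (is "_ \<longleftrightarrow> ?R")
proof -
  have iff: "is_cycle C z \<longleftrightarrow>
      (\<forall>i. z $ i \<in> C i \<and> (\<forall>a\<in>C i. (z $ cyc_pred i - z $ i) \<bullet> (a - z $ i) \<le> 0))"
    by (simp add: is_cycle_def nearest_point_iff[OF assms])
  show ?thesis
  proof
    assume "is_cycle C z"
    then show ?R
      unfolding iff by (auto simp: prod_set_def inner_vec_def shift_diff_nth intro!: sum_nonpos)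
  next
    assume R: ?R
    have "(z $ cyc_pred i - z $ i) \<bullet> (a - z $ i) \<le> 0" if "a \<in> C i" for i a
    proof -
      define c where "c = (\<chi> j. if j = i then a else z $ j)"
      have "c \<in> prod_set C"
        using R that by (auto simp: c_def prod_set_def)
      then have "shift_diff z \<bullet> (c - z) \<le> 0"
        using R by blast
      moreover have "shift_diff z $ j \<bullet> (c - z) $ j
          = (if j = i then (z $ cyc_pred i - z $ i) \<bullet> (a - z $ i) else 0)" for j
        by (simp add: c_def shift_diff_nth)
      ultimately show ?thesis
        by (simp add: inner_vec_def)
    qed
    with R show "is_cycle C z"
      unfolding iff by (auto simp: prod_set_def)
  qed
qed

lemma is_cycle_iff_shift_diff:
  fixes C :: "'n::{finite,linorder} \<Rightarrow> 'h::{real_inner,banach} set"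
  assumes C: "\<And>j. C j \<noteq> {}" "\<And>j. closed (C j)" "\<And>j. convex (C j)"
    and de: "difference_pair C d e"
  shows "is_cycle C z \<longleftrightarrow> z \<in> prod_set C \<and> shift_diff z = d"
proof -
  let ?P = "prod_set C"
  have ne: "?P \<noteq> {}"
    using C by (simp add: prod_set_nonempty)
  have d: "d = shift_diff e"
    and sub: "\<And>x. support_fun ?P d + ereal ((shift_diff x - d) \<bullet> e) - support_fun ?P (shift_diff x) \<le> 0"
    and D: "support_fun ?P d + ereal ((1/2) * (norm d)\<^sup>2) \<le> 0"
    using de by (auto simp: difference_pair_def D_set_def)
  from D have "support_fun ?P d \<le> ereal (- (1/2) * (norm d)\<^sup>2)"
    by (cases "support_fun ?P d") auto
  then obtain s where s: "support_fun ?P d = ereal s" "s \<le> - (1/2) * (norm d)\<^sup>2"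
    and ub: "\<And>c. c \<in> ?P \<Longrightarrow> c \<bullet> d \<le> s"
    using support_fun_finite[OF ne] by metis
  show ?thesis
    unfolding is_cycle_iff_normal[OF C]
  proof (intro conj_cong refl iffI ballI)
    \<comment> \<open>Membership of \<open>d\<close> in \<open>D_set\<close> gives <c, d> <= s <=
      -|d|^2 / 2 = <z, d>.\<close>
    fix c assume "z \<in> ?P" "shift_diff z = d" "c \<in> ?P"
    then show "shift_diff z \<bullet> (c - z) \<le> 0"
      using ub[of c] s(2) inner_shift_diff[of z] by (simp add: inner_diff_right inner_commute)
  next
    assume z: "z \<in> ?P" and "\<forall>c\<in>?P. shift_diff z \<bullet> (c - z) \<le> 0"
    then have "support_fun ?P (shift_diff z) \<le> ereal (z \<bullet> shift_diff z)"
      by (auto simp: support_fun_le_iff inner_diff_right inner_commute)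
    then obtain t where t: "support_fun ?P (shift_diff z) = ereal t" "t \<le> z \<bullet> shift_diff z"
      using support_fun_finite[OF ne] by metis
    \<comment> \<open>Bounding \<open>s\<close> below by <z, d> and \<open>t\<close> above by <z,
      Sz> leaves <z - e, S(z - e)> >= 0. This form equals -|S(z - e)|^2 / 2, so S(z - e)
      vanishes.\<close>
    have "s + (shift_diff z - d) \<bullet> e \<le> t"
      using sub[of z] by (simp add: s t)
    then have "0 \<le> (z - e) \<bullet> shift_diff (z - e)"
      using ub[OF z] t(2) by (simp add: shift_diff_diff d inner_diff inner_commute)
    then have "shift_diff (z - e) = 0"
      by (simp add: inner_shift_diff)
    then show "shift_diff z = d"
      by (simp add: shift_diff_diff d)
  qed
qed

text \<open>The equations z_i = z_{i-1} + v_{i-1} for i = 2, ..., m telescope to the partial sums.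
  The wrap-around equation z_1 = z_m + v_m is the case k = 1 combined with the vanishing total
  sum.\<close>

lemma shift_diff_eq_iff_partial_sums:
  fixes z d v :: "'h::real_vector ^ 'n::{finite,linorder}"
  assumes d: "\<And>i. d $ i = - v $ cyc_pred i" and v: "(\<Sum>i\<in>UNIV. v $ i) = 0"
  shows "shift_diff z = d \<longleftrightarrow> (\<forall>k. z $ Max UNIV = z $ k + (\<Sum>i\<in>{k..<Max UNIV}. v $ i))"
    (is "_ \<longleftrightarrow> (\<forall>k. ?Q k)")
proof
  assume "shift_diff z = d"
  then have step: "z $ i = z $ cyc_pred i + v $ cyc_pred i" for i
    using shift_diff_nth[of z i] d[of i] by (simp add: algebra_simps eq_neg_iff_add_eq_0)
  show "\<forall>k. ?Q k"
  proof
    fix k show "?Q k"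
    proof (rule cyc_pred_induct[of ?Q])
      fix i :: 'n assume "?Q i" "i \<noteq> Min UNIV"
      then show "?Q (cyc_pred i)"
        using sum_atLeastLessThan_cyc_pred[of i "($) v"] step[of i] by (simp add: add.assoc)
    qed simp
  qed
next
  assume Q: "\<forall>k. ?Q k"
  have "z $ cyc_pred i - z $ i = - v $ cyc_pred i" for i
  proof (cases "i = Min UNIV")
    case True
    have "(UNIV :: 'n set) = insert (Max UNIV) {Min UNIV..<Max UNIV}"
      by (auto simp: order_less_le)
    then have "(\<Sum>i\<in>UNIV. v $ i) = v $ Max UNIV + (\<Sum>i\<in>{Min UNIV..<Max UNIV}. v $ i)"
      by (metis atLeastLessThan_iff finite_code less_irrefl sum.insert)
    then show ?thesis
      using True v Q by (metis add_diff_cancel_left' cyc_pred_Min eq_neg_iff_add_eq_0 add.commute)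
  next
    case False
    have "z $ cyc_pred i + (v $ cyc_pred i + (\<Sum>j\<in>{i..<Max UNIV}. v $ j))
        = z $ i + (\<Sum>j\<in>{i..<Max UNIV}. v $ j)"
      using Q[rule_format, of "cyc_pred i"] Q[rule_format, of i] sum_atLeastLessThan_cyc_pred[OF False, of "($) v"]
      by simp
    then show ?thesis
      by (simp add: algebra_simps eq_neg_iff_add_eq_0)
  qed
  then show "shift_diff z = d"
    by (simp add: vec_eq_iff shift_diff_nth d)
qed

theorem theorem10:
  fixes C :: "'n::{finite,linorder} \<Rightarrow> 'h::{real_inner,banach} set"
  assumes "CARD('n) \<ge> 2"
    and "\<And>j. C j \<noteq> {}"
    and "\<And>j. closed (C j)"
    and "\<And>j. convex (C j)"
  shows "(\<exists>d e. difference_pair C d e) \<and>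
    (\<forall>d e v. difference_pair C d e \<longrightarrow> v = - ((cyc_shift ^^ (CARD('n) - 1)) d) \<longrightarrow>
       (\<Sum>i\<in>UNIV. v $ i) = 0 \<and>
       {z $ Max UNIV | z. is_cycle C z} =
         (\<Inter>k. (\<lambda>u. u + (\<Sum>i\<in>{k..<Max UNIV}. v $ i)) ` C k))"
proof (intro conjI allI impI)
  show "\<exists>d e. difference_pair C d e"
    using difference_pair_exists assms by blast
next
  fix d e v :: "'h ^ 'n::{finite,linorder}"
  assume de: "difference_pair C d e" and v: "v = - ((cyc_shift ^^ (CARD('n) - 1)) d)"
  \<comment> \<open>Since R has period m, R^(m-1) inverts R, so v = -R^(m-1) d means d =
    -Rv.\<close>
  have "(cyc_pred ^^ (CARD('n) - 1)) (cyc_pred i) = i" for i :: 'n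
    using cyc_pred_funpow_card[of i] by (cases "CARD('n)") (auto simp: funpow_swap1)
  then have dv: "d $ i = - v $ cyc_pred i" for i
    by (simp add: v cyc_shift_funpow_nth)
  have "(\<Sum>i\<in>UNIV. v $ i) = (\<Sum>i\<in>UNIV. - d $ i)"
    using sum_cyc_pred[of "($) v"] by (simp add: dv)
  also have "\<dots> = 0"
    using de by (auto simp: difference_pair_def sum_negf simp flip: mean_zero_iff)
  finally show v0: "(\<Sum>i\<in>UNIV. v $ i) = 0" .
  define p where "p k = (\<Sum>i\<in>{k..<Max UNIV}. v $ i)" for k
  have cycle: "is_cycle C z \<longleftrightarrow> (\<forall>k. z $ k \<in> C k \<and> z $ Max UNIV = z $ k + p k)" for z
    unfolding is_cycle_iff_shift_diff[OF assms(2-4) de] shift_diff_eq_iff_partial_sums[OF dv v0]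
    by (auto simp: prod_set_def p_def)
  have "{z $ Max UNIV | z. is_cycle C z} = (\<Inter>k. (\<lambda>u. u + p k) ` C k)"
  proof (intro set_eqI iffI)
    fix w assume w: "w \<in> (\<Inter>k. (\<lambda>u. u + p k) ` C k)"
    \<comment> \<open>The last entry determines the whole cycle. As \<open>p (Max UNIV)\<close> is
      an empty sum, the last entry of \<open>z\<close> is \<open>w\<close> itself.\<close>
    define z where "z = (\<chi> k. w - p k)"
    have "w - p k \<in> C k" for k
    proof -
      from w have "w \<in> (\<lambda>u. u + p k) ` C k"
        by blast
      then show ?thesis
        by force
    qed
    moreover have "z $ Max UNIV = w"
      by (simp add: z_def p_def)
    ultimately show "w \<in> {z $ Max UNIV | z. is_cycle C z}"
      unfolding cycle by (auto simp: z_def intro!: exI[of _ z])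
  qed (auto simp: cycle)
  then show "{z $ Max UNIV | z. is_cycle C z} =
      (\<Inter>k. (\<lambda>u. u + (\<Sum>i\<in>{k..<Max UNIV}. v $ i)) ` C k)"
    by (simp add: p_def)
qed

end
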